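(* Let $r$, $t$, $s$ and $p$ be four real numbers satisfying the following two conditions: (i) $0<s<t<r$; (ii) $0<p\leq \frac{4t+2s}{3}$. Then, for any positive real numbers $a$ and $b$ such that $a\neq b$, we have $$\frac{2^{-p/r}-2^{-p/s}}{2^{-p/t}-2^{-p/s}}<\frac{M_r^p(a,b)-M_s^p(a,b)}{M_t^p(a,b)-M_s^p(a,b)}<\frac{r-s}{t-s}.$$
   Context: For positive reals $a,b$ and a nonzero real $u$, $M_u(a,b)=\left(\frac{a^u+b^u}{2}\right)^{1/u}$ is the power mean of order $u$. The notation $M_u^p(a,b)$ means $(M_u(a,b))^p$. *)

theory Defs
  imports "HOL-Analysis.Analysis"
begin

text \<open>Meaningful for \<open>a, b > 0\<close> and \<open>u \<noteq> 0\<close> only.\<close>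

definition power_mean :: "real \<Rightarrow> real \<Rightarrow> real \<Rightarrow> real" where
  "power_mean u a b = ((a powr u + b powr u) / 2) powr (1 / u)"

end

theory Submission
  imports Defs "HOL-Real_Asymp.Real_Asymp"
begin

text \<open>
  Writing \<open>y = \<bar>ln a - ln b\<bar> / 2\<close>, the \<open>p\<close>-th power of the mean of order \<open>u\<close> is proportional to
  \<open>exp (p * ln (cosh (u * y)) / u)\<close>, so the ratio of differences becomes \<open>f y / g y\<close> with
  \<open>f 0 = g 0 = 0\<close>. The two bounds are its limits as \<open>y\<close> tends to infinity and to \<open>0\<close>, and by the
  monotone form of l'Hospital's rule it is enough that \<open>f' / g'\<close> is decreasing. Taking the
  logarithmic derivative of \<open>f' / g'\<close>, this says that
  \<open>k(u) = (u * (1 - tanh (u * y)^2) - s * (1 - tanh (s * y)^2)) / (tanh (u * y) - tanh (s * y)) + p * tanh (u * y)\<close>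
  decreases in \<open>u \<ge> t\<close>, and \<open>k'(u) < 0\<close> is a hyperbolic inequality in \<open>X = u * y\<close> and
  \<open>Y = s * y\<close> which follows from its case \<open>Y = 0\<close> by increasing \<open>Y\<close> with \<open>X - Y\<close> fixed.
\<close>

section \<open>Hyperbolic inequalities\<close>

lemma sinh_less_mult_cosh:
  fixes x :: real
  assumes "x > 0"
  shows "sinh x < x * cosh x"
proof -
  have "(\<lambda>z. z * cosh z - sinh z) 0 < (\<lambda>z. z * cosh z - sinh z) x"
  proof (rule DERIV_pos_imp_increasing_open[OF assms])
    fix z :: real assume "0 < z" "z < x"
    then show "\<exists>d. ((\<lambda>z. z * cosh z - sinh z) has_real_derivative d) (at z) \<and> d > 0"
      by (intro exI[of _ "z * sinh z"]) (auto intro!: derivative_eq_intros simp: field_simps)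
  qed (auto intro!: continuous_intros)
  then show ?thesis by simp
qed

lemma tanh_less_self:
  fixes x :: real
  assumes "x > 0"
  shows "tanh x < x"
  using sinh_less_mult_cosh[OF assms] by (simp add: tanh_def field_simps)

text \<open>The hyperbolic Cusa-Huygens inequality. The right side minus the left vanishes at 0
  together with its derivative, and its second derivative \<open>x * cosh x - sinh x\<close> is
  positive by \<open>sinh_less_mult_cosh\<close>.\<close>

lemma three_sinh_less:
  fixes x :: real
  assumes "x > 0"
  shows "3 * sinh x < x * (cosh x + 2)"
proof -
  have 1: "2 * cosh y < y * sinh y + 2" if "y > 0" for y :: real
  proof -
    have "(\<lambda>y. y * sinh y + 2 - 2 * cosh y) 0 < (\<lambda>y. y * sinh y + 2 - 2 * cosh y) y"
    proof (rule DERIV_pos_imp_increasing_open[OF that])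
      fix z :: real assume "0 < z" "z < y"
      then show "\<exists>d. ((\<lambda>y. y * sinh y + 2 - 2 * cosh y) has_real_derivative d) (at z) \<and> d > 0"
        using sinh_less_mult_cosh[of z]
        by (intro exI[of _ "z * cosh z - sinh z"]) (auto intro!: derivative_eq_intros simp: field_simps)
    qed (auto intro!: continuous_intros)
    then show ?thesis by simp
  qed
  have "(\<lambda>y. y * (cosh y + 2) - 3 * sinh y) 0 < (\<lambda>y. y * (cosh y + 2) - 3 * sinh y) x"
  proof (rule DERIV_pos_imp_increasing_open[OF assms])
    fix z :: real assume "0 < z" "z < x"
    then show "\<exists>d. ((\<lambda>y. y * (cosh y + 2) - 3 * sinh y) has_real_derivative d) (at z) \<and> d > 0"
      using 1[of z]
      by (intro exI[of _ "z * sinh z + 2 - 2 * cosh z"]) (auto intro!: derivative_eq_intros simp: field_simps)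
  qed (auto intro!: continuous_intros)
  then show ?thesis by simp
qed

lemma tanh_square_less_1:
  fixes x :: real
  shows "(tanh x)\<^sup>2 < 1"
  using tanh_real_bounds[of x] by (simp add: abs_square_less_1 abs_if)

text \<open>Comes from \<open>three_sinh_less\<close> at \<open>2 * x\<close> by the double-argument
  formulas. Up to the factor 3 it is the case \<open>Y = 0\<close> of
  \<open>tanh_diff_inequality\<close>.\<close>

lemma three_tanh_less:
  fixes x :: real
  assumes "x > 0"
  shows "3 * tanh x + x * (tanh x)\<^sup>2 < 3 * x"
proof -
  have "3 * (2 * sinh x * cosh x) < 2 * x * ((cosh x)\<^sup>2 + (sinh x)\<^sup>2 + 2)"
    using three_sinh_less[of "2 * x"] assms by (simp add: sinh_double cosh_double)
  then have "3 * sinh x * cosh x < x * (2 * (cosh x)\<^sup>2 + 1)"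
    using cosh_square_eq[of x] by (simp add: algebra_simps)
  then have "3 * sinh x * cosh x + x * (sinh x)\<^sup>2 < 3 * x * (cosh x)\<^sup>2"
    using cosh_square_eq[of x] by (simp add: algebra_simps)
  then have "(3 * sinh x * cosh x + x * (sinh x)\<^sup>2) / (cosh x)\<^sup>2 < 3 * x"
    by (simp add: divide_less_eq)
  moreover have "(3 * sinh x * cosh x + x * (sinh x)\<^sup>2) / (cosh x)\<^sup>2 = 3 * tanh x + x * (tanh x)\<^sup>2"
    by (simp add: tanh_def add_divide_distrib power_divide power2_eq_square)
  ultimately show ?thesis by simp
qed

lemma tanh_diff_inequality:
  fixes X Y :: real
  assumes "0 < Y" "Y < X"
  defines "d \<equiv> tanh X - tanh Y"
  shows "d + (X + 2 * Y) / 3 * d\<^sup>2 < (X - Y) * (1 - (tanh Y)\<^sup>2)"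
proof -
  define D where "D = X - Y"
  have D: "D > 0" and X: "X = Y + D" using assms by (auto simp: D_def)
  have T: "tanh D > 0" using D by simp
  \<comment> \<open>With \<open>D\<close> fixed, \<open>G z\<close> is the right side minus the
    left, divided by \<open>d\<close>, at the point \<open>Y = z\<close>, \<open>X = z + D\<close>.
    The subtraction formula \<open>mult\<close> turns the quotient
    \<open>D * (1 - x * w) / (x - w)\<close> into \<open>D / tanh D\<close>, which does not depend
    on \<open>z\<close>.\<close>
  define G where "G = (\<lambda>z. D / tanh D - 1 - (3 * z + D) / 3 * tanh (z + D) + (3 * z + 4 * D) / 3 * tanh z)"
  define G' where "G' = (\<lambda>z. - tanh (z + D) - (3 * z + D) / 3 * (1 - (tanh (z + D))\<^sup>2)
      + tanh z + (3 * z + 4 * D) / 3 * (1 - (tanh z)\<^sup>2))"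
  have mult: "tanh D * (1 - tanh (z + D) * tanh z) = tanh (z + D) - tanh z" for z
  proof -
    have "tanh D = tanh (z + D - z)" by simp
    also have "\<dots> = (tanh (z + D) - tanh z) / (1 - tanh (z + D) * tanh z)"
      using tanh_add[of "z + D" "- z"] by simp
    finally have e: "tanh D = (tanh (z + D) - tanh z) / (1 - tanh (z + D) * tanh z)" .
    \<comment> \<open>Division by zero yields 0, so a vanishing denominator in \<open>e\<close>
      would force \<open>tanh D = 0\<close>.\<close>
    moreover have "1 - tanh (z + D) * tanh z \<noteq> 0" using e T by auto
    ultimately show ?thesis by (simp add: field_simps)
  qed
  have "G 0 \<le> G Y"
  proof (rule DERIV_nonneg_imp_nondecreasing[where f = G])
    show "0 \<le> Y" using assms by simp
    fix z :: real assume z: "0 \<le> z" "z \<le> Y"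
    have der: "(G has_real_derivative G' z) (at z)"
      unfolding G_def G'_def by (auto intro!: derivative_eq_intros simp: field_simps)
    define x w where "x = tanh (z + D)" and "w = tanh z"
    have bounds: "0 \<le> w" "w < x" "x < 1"
      using z D by (auto simp: x_def w_def tanh_real_lt_1)
    have xw: "x * w < 1"
      using bounds mult_strict_mono'[of x 1 w 1] by simp
    have "w\<^sup>2 < 1" "w\<^sup>2 \<le> x\<^sup>2" "x\<^sup>2 < 1"
      using tanh_square_less_1 bounds by (auto simp: x_def w_def power_mono)
    have "w \<le> z" using tanh_less_self[of z] z by (cases "z = 0") (auto simp: w_def)
    have "G' z = z * (x\<^sup>2 - w\<^sup>2) + D * (3 - 4 * w\<^sup>2 + x\<^sup>2) / 3 - (x - w)"
      by (simp add: G'_def x_def w_def field_simps)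
    \<comment> \<open>Both coefficients are nonnegative, the second because it is
      \<open>3 * (1 - w\<^sup>2) + (x\<^sup>2 - w\<^sup>2)\<close> up to the factor 3. Replacing
      \<open>z\<close> by \<open>w\<close> and \<open>D\<close> by \<open>tanh D\<close> makes
      \<open>tanh D\<close> a common factor of all terms, after which the sign is visible.\<close>
    also have "\<dots> \<ge> w * (x\<^sup>2 - w\<^sup>2) + tanh D * (3 - 4 * w\<^sup>2 + x\<^sup>2) / 3 - (x - w)"
      using \<open>w \<le> z\<close> tanh_less_self[OF D] \<open>w\<^sup>2 \<le> x\<^sup>2\<close> \<open>w\<^sup>2 < 1\<close>
      by (intro diff_mono add_mono mult_right_mono divide_right_mono) auto
    also have "x - w = tanh D * (1 - x * w)"
      using mult[of z] by (simp add: x_def w_def)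
    also have "x\<^sup>2 - w\<^sup>2 = (x + w) * (tanh D * (1 - x * w))"
      unfolding mult[of z, folded x_def w_def] by (simp add: power2_eq_square algebra_simps)
    also have "w * ((x + w) * (tanh D * (1 - x * w))) + tanh D * (3 - 4 * w\<^sup>2 + x\<^sup>2) / 3 - tanh D * (1 - x * w)
        = tanh D * (x * w * ((1 - x * w) + (1 - w\<^sup>2)) + (x\<^sup>2 - w\<^sup>2) / 3)"
      by (simp add: field_simps power2_eq_square)
    finally have "G' z \<ge> tanh D * (x * w * ((1 - x * w) + (1 - w\<^sup>2)) + (x\<^sup>2 - w\<^sup>2) / 3)" .
    moreover have "tanh D * (x * w * ((1 - x * w) + (1 - w\<^sup>2)) + (x\<^sup>2 - w\<^sup>2) / 3) \<ge> 0"
      using T bounds xw \<open>w\<^sup>2 < 1\<close> \<open>w\<^sup>2 \<le> x\<^sup>2\<close> by (intro mult_nonneg_nonneg add_nonneg_nonneg) auto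
    ultimately show "\<exists>d. (G has_real_derivative d) (at z) \<and> d \<ge> 0" using der by force
  qed
  moreover have "G 0 > 0"
    using three_tanh_less[OF D] T by (simp add: G_def field_simps power2_eq_square)
  ultimately have G: "G Y > 0" by simp
  define x w where "x = tanh X" and "w = tanh Y"
  have pos: "x - w > 0" and d: "d = x - w" using assms by (auto simp: x_def w_def d_def)
  have nz: "1 - x * w \<noteq> 0" using mult[of Y] pos by (auto simp: x_def w_def X)
  then have "tanh D = (x - w) / (1 - x * w)"
    using mult[of Y] by (simp add: x_def w_def X field_simps)
  then have "G Y = D * (1 - x * w) / (x - w) - 1 - (X + 2 * Y) / 3 * x + (4 * X - Y) / 3 * w"
    by (simp add: G_def x_def w_def X)
  then have "(x - w) * G Y = D * (1 - x * w) - (x - w) - (X + 2 * Y) / 3 * x * (x - w)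
      + (4 * X - Y) / 3 * w * (x - w)"
    using pos by (simp add: field_simps)
  also have "\<dots> = D * (1 - w\<^sup>2) - (x - w) - (X + 2 * Y) / 3 * (x - w)\<^sup>2"
    unfolding X by (simp add: field_simps power2_eq_square)
  finally show ?thesis
    using mult_pos_pos[OF pos G] unfolding d by (simp add: D_def w_def)
qed

text \<open>The derivative of \<open>k\<close> at \<open>u\<close> has the sign of
  \<open>N = d - (X - Y) * W - X * d\<^sup>2 + p * y * d\<^sup>2\<close>. The upper bound on
  \<open>p\<close> makes the last two terms together at most
  \<open>(X + 2 * Y) / 3 * d\<^sup>2\<close>, and \<open>tanh_diff_inequality\<close> then gives
  \<open>N < 0\<close>.\<close>

lemma log_deriv_decreasing:
  fixes r s t p y :: real
  assumes "0 < s" "s < t" "t < r" "p \<le> (4 * t + 2 * s) / 3" "y > 0"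
  defines "k \<equiv> \<lambda>u. (u * (1 - (tanh (u * y))\<^sup>2) - s * (1 - (tanh (s * y))\<^sup>2))
                     / (tanh (u * y) - tanh (s * y)) + p * tanh (u * y)"
  shows "k r < k t"
proof (rule DERIV_neg_imp_decreasing[OF \<open>t < r\<close>])
  fix u assume u: "t \<le> u" "u \<le> r"
  define X Y where "X = u * y" and "Y = s * y"
  define x w where "x = tanh X" and "w = tanh Y"
  define d K W where "d = x - w" and "K = 1 - x\<^sup>2" and "W = 1 - w\<^sup>2"
  have XY: "0 < Y" "Y < X" using assms u by (auto simp: X_def Y_def)
  then have d: "d > 0" by (simp add: x_def w_def d_def)
  have K: "K > 0" using tanh_square_less_1[of X] by (simp add: x_def K_def)
  define N where "N = (1 - 2 * X * x + p * y * d) * d - (X * K - Y * W)"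
  have "(k has_real_derivative
      ((K + u * (- 2 * x * (y * K))) * d - (u * K - s * W) * (y * K)) / d\<^sup>2 + p * (y * K)) (at u)"
    using d unfolding k_def K_def W_def d_def x_def w_def X_def Y_def
    by (auto intro!: derivative_eq_intros simp: power2_eq_square)
  also have "((K + u * (- 2 * x * (y * K))) * d - (u * K - s * W) * (y * K)) / d\<^sup>2 + p * (y * K)
      = ((K + u * (- 2 * x * (y * K))) * d - (u * K - s * W) * (y * K) + p * (y * K) * d\<^sup>2) / d\<^sup>2"
    using d by (simp add: add_divide_distrib)
  also have "(K + u * (- 2 * x * (y * K))) * d - (u * K - s * W) * (y * K) + p * (y * K) * d\<^sup>2 = K * N"
    by (simp add: N_def X_def Y_def power2_eq_square algebra_simps)
  finally have der: "(k has_real_derivative K * N / d\<^sup>2) (at u)" .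
  \<comment> \<open>The bound on \<open>p\<close> is assumed at \<open>t\<close> and only weakens as
    \<open>u\<close> grows from \<open>t\<close>.\<close>
  have "p * y \<le> (4 * u + 2 * s) / 3 * y"
    using assms u by (intro mult_right_mono) auto
  then have "p * y \<le> (4 * X + 2 * Y) / 3" by (simp add: X_def Y_def field_simps)
  then have "p * y * d\<^sup>2 \<le> (4 * X + 2 * Y) / 3 * d\<^sup>2" by (intro mult_right_mono) auto
  moreover have "d + (X + 2 * Y) / 3 * d\<^sup>2 < (X - Y) * W"
    using tanh_diff_inequality[OF XY] by (simp add: x_def w_def d_def W_def)
  moreover have "N = d - (X - Y) * W - X * d\<^sup>2 + p * y * d\<^sup>2"
    by (simp add: N_def K_def W_def d_def power2_eq_square algebra_simps)
  moreover have "(4 * X + 2 * Y) / 3 * d\<^sup>2 = (X + 2 * Y) / 3 * d\<^sup>2 + X * d\<^sup>2"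
    by (simp add: field_simps)
  ultimately have "N < 0" by linarith
  then have "K * N / d\<^sup>2 < 0" using K d by (intro divide_neg_pos mult_pos_neg) auto
  with der show "\<exists>d. (k has_real_derivative d) (at u) \<and> d < 0" by blast
qed

section \<open>Monotone l'Hospital rule\<close>

text \<open>Cauchy's mean value theorem gives \<open>f z / g z = f' c / g' c\<close> for some
  \<open>c < z\<close>, which exceeds \<open>f' z / g' z\<close>; hence \<open>f / g\<close> has
  negative derivative and decreases.\<close>

lemma monotone_lhopital_bounds:
  fixes f g f' g' :: "real \<Rightarrow> real" and l L y :: real
  assumes f: "\<And>z. z \<ge> 0 \<Longrightarrow> (f has_real_derivative f' z) (at z)"
    and g: "\<And>z. z \<ge> 0 \<Longrightarrow> (g has_real_derivative g' z) (at z)"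
    and f0: "f 0 = 0" and g0: "g 0 = 0"
    and g'_pos: "\<And>z. z > 0 \<Longrightarrow> g' z > 0"
    and decr: "\<And>u v. 0 < u \<Longrightarrow> u < v \<Longrightarrow> f' v / g' v < f' u / g' u"
    and lim0: "((\<lambda>z. f' z / g' z) \<longlongrightarrow> l) (at_right 0)"
    and lim_top: "((\<lambda>z. f z / g z) \<longlongrightarrow> L) at_top"
    and y: "y > 0"
  shows "L < f y / g y \<and> f y / g y < l"
proof -
  have g_pos: "g z > 0" if "z > 0" for z
  proof -
    have "g 0 < g z"
    proof (rule DERIV_pos_imp_increasing_open[OF that])
      show "\<exists>d. (g has_real_derivative d) (at v) \<and> d > 0" if "0 < v" for v
        using g[of v] g'_pos[of v] that by auto
      show "continuous_on {0..z} g"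
        using g by (intro DERIV_atLeastAtMost_imp_continuous_on) auto
    qed
    then show ?thesis using g0 by simp
  qed
  have mvt: "\<exists>c. 0 < c \<and> c < z \<and> f z / g z = f' c / g' c" if z: "z > 0" for z
  proof -
    have "\<exists>c. 0 < c \<and> c < z \<and> (f z - f 0) * g' c = (g z - g 0) * f' c"
      using z
    proof (rule GMVT')
      show "isCont f v" "isCont g v" if "0 \<le> v" for v
        using f[OF that] g[OF that] by (auto intro: DERIV_isCont)
    qed (use f g in auto)
    then obtain c where c: "0 < c" "c < z" "f z * g' c = g z * f' c"
      using f0 g0 by auto
    then have "f z / g z = f' c / g' c"
      using g_pos[OF z] g'_pos[of c] by (simp add: field_simps)
    then show ?thesis using c by blast
  qed
  have decr_fg: "f v / g v < f u / g u" if uv: "0 < u" "u < v" for u v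
  proof (rule DERIV_neg_imp_decreasing[OF \<open>u < v\<close>])
    fix z assume "u \<le> z" "z \<le> v"
    then have z: "z > 0" using uv by simp
    obtain c where c: "0 < c" "c < z" "f z / g z = f' c / g' c" using mvt[OF z] by blast
    have "f' z / g' z < f z / g z" using decr[OF c(1,2)] c(3) by simp
    then have "f' z * g z - f z * g' z < 0"
      using g_pos[OF z] g'_pos[OF z] by (simp add: field_simps)
    then have "(f' z * g z - f z * g' z) / (g z * g z) < 0"
      using g_pos[OF z] by (intro divide_neg_pos) auto
    moreover have "((\<lambda>z. f z / g z) has_real_derivative (f' z * g z - f z * g' z) / (g z * g z)) (at z)"
      using f[of z] g[of z] g_pos[OF z] z by (intro DERIV_divide) auto
    ultimately show "\<exists>d. ((\<lambda>z. f z / g z) has_real_derivative d) (at z) \<and> d < 0" by blast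
  qed
  \<comment> \<open>A limit yields only a weak inequality, so strictness is gained by comparing at
    \<open>y + 1\<close> first; \<open>c / 2\<close> serves the same purpose for the upper
    bound.\<close>
  have "L \<le> f (y + 1) / g (y + 1)"
    using lim_top
  proof (rule tendsto_upperbound)
    show "eventually (\<lambda>z. f z / g z \<le> f (y + 1) / g (y + 1)) at_top"
      using eventually_gt_at_top[of "y + 1"]
      by eventually_elim (use decr_fg y in \<open>force intro: less_imp_le\<close>)
  qed auto
  also have "\<dots> < f y / g y" using decr_fg[of y "y + 1"] y by simp
  finally have lower: "L < f y / g y" .
  obtain c where c: "0 < c" "f y / g y = f' c / g' c" using mvt[OF y] by blast
  have "f y / g y < f' (c / 2) / g' (c / 2)" using decr[of "c / 2" c] c by simp
  also have "\<dots> \<le> l"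
    using lim0
  proof (rule tendsto_lowerbound)
    have "eventually (\<lambda>z. z \<in> {0<..<c / 2}) (at_right 0)"
      using c by (intro eventually_at_right_real) auto
    then show "eventually (\<lambda>z. f' (c / 2) / g' (c / 2) \<le> f' z / g' z) (at_right 0)"
      by eventually_elim (use decr[of _ "c / 2"] in \<open>force intro: less_imp_le\<close>)
  qed auto
  finally show ?thesis using lower by blast
qed

section \<open>Power means in hyperbolic form\<close>

text \<open>Writing \<open>a = exp (m + v)\<close> and \<open>b = exp (m - v)\<close>, the average
  of the \<open>u\<close>-th powers is \<open>exp (u * m) * cosh (u * v)\<close>. As
  \<open>cosh\<close> is even, \<open>v\<close> may be replaced by its absolute value
  \<open>y\<close>.\<close>

lemma power_mean_powr_eq:
  fixes a b u p :: real
  assumes "a > 0" "b > 0" "u \<noteq> 0"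
  defines "y \<equiv> \<bar>ln a - ln b\<bar> / 2"
  shows "power_mean u a b powr p = exp (p * (ln a + ln b) / 2) * exp (p * (ln (cosh (u * y)) / u))"
proof -
  define m v where "m = (ln a + ln b) / 2" and "v = (ln a - ln b) / 2"
  have "cosh (u * y) = cosh \<bar>u * y\<bar>" by (simp only: cosh_real_abs)
  also have "\<bar>u * y\<bar> = \<bar>u * v\<bar>" by (simp add: y_def v_def abs_mult)
  finally have c: "cosh (u * y) = cosh (u * v)" by (simp only: cosh_real_abs)
  have "exp (u * m) * cosh (u * y) = (exp (u * m + u * v) + exp (u * m - u * v)) / 2"
    unfolding c by (simp add: cosh_field_def distrib_left flip: exp_add)
  also have "u * m + u * v = u * ln a" by (simp add: m_def v_def field_simps)
  also have "u * m - u * v = u * ln b" by (simp add: m_def v_def field_simps)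
  finally have "(a powr u + b powr u) / 2 = exp (u * m) * cosh (u * y)"
    using assms by (simp add: powr_def)
  then have "power_mean u a b powr p = exp (p * (1 / u * ln (exp (u * m) * cosh (u * y))))"
    by (simp add: power_mean_def powr_def)
  also have "1 / u * ln (exp (u * m) * cosh (u * y)) = m + ln (cosh (u * y)) / u"
    using assms by (simp add: ln_mult field_simps)
  finally show ?thesis by (simp add: m_def distrib_left exp_add)
qed

lemma cosh_power_difference_ratio_bounds:
  fixes r s t p y :: real
  assumes rst: "0 < s" "s < t" "t < r" and p: "0 < p" "p \<le> (4 * t + 2 * s) / 3" and y: "y > 0"
  defines "F \<equiv> \<lambda>u z. exp (p * (ln (cosh (u * z)) / u - ln (cosh (s * z)) / s)) - 1"
    and "L \<equiv> \<lambda>u. exp (p * (ln 2 / s - ln 2 / u)) - 1"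
  shows "L r / L t < F r y / F t y \<and> F r y / F t y < (r - s) / (t - s)"
proof -
  \<comment> \<open>\<open>B u\<close> and \<open>C u\<close> are the first and second derivatives
    of \<open>A u\<close>, and \<open>F u z = exp (p * A u z) - 1\<close>.\<close>
  define A where "A = (\<lambda>u z. ln (cosh (u * z)) / u - ln (cosh (s * z)) / s)"
  define B where "B = (\<lambda>u z. tanh (u * z) - tanh (s * z))"
  define C where "C = (\<lambda>u z. u * (1 - (tanh (u * z))\<^sup>2) - s * (1 - (tanh (s * z))\<^sup>2))"
  have A: "(A u has_real_derivative B u z) (at z)" if "u > 0" for u z
    unfolding A_def B_def using that rst
    by (auto intro!: derivative_eq_intros simp: tanh_def)
  have B: "(B u has_real_derivative C u z) (at z)" for u z
    unfolding B_def C_def by (auto intro!: derivative_eq_intros)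
  have B_pos: "B u z > 0" if "u > s" "z > 0" for u z
    using that by (simp add: B_def)
  have F: "(F u has_real_derivative p * B u z * exp (p * A u z)) (at z)" if "u > 0" for u z
  proof -
    have "((\<lambda>z. exp (p * A u z) - 1) has_real_derivative p * B u z * exp (p * A u z)) (at z)"
      by (rule DERIV_cong[OF DERIV_diff[OF DERIV_chain2[OF DERIV_exp DERIV_cmult[OF A[OF that]]] DERIV_const]])
        simp
    then show ?thesis by (simp add: F_def A_def)
  qed
  have quot: "(p * B r z * exp (p * A r z)) / (p * B t z * exp (p * A t z))
      = B r z / B t z * exp (p * (A r z - A t z))" for z
    using p by (simp add: exp_diff right_diff_distrib)
  have decr: "B r v / B t v * exp (p * (A r v - A t v)) < B r u / B t u * exp (p * (A r u - A t u))"
    if uv: "0 < u" "u < v" for u v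
  proof -
    \<comment> \<open>The logarithm of the quotient of the derivatives of \<open>F r\<close> and
      \<open>F t\<close>; its derivative is the difference of the two values compared in
      \<open>log_deriv_decreasing\<close>.\<close>
    define Q where "Q = (\<lambda>z. ln (B r z) - ln (B t z) + p * (A r z - A t z))"
    have "Q v < Q u"
    proof (rule DERIV_neg_imp_decreasing[OF uv(2)])
      fix z assume "u \<le> z" "z \<le> v"
      then have z: "z > 0" using uv by simp
      have der: "(Q has_real_derivative (C r z / B r z - C t z / B t z + p * (B r z - B t z))) (at z)"
        unfolding Q_def using rst B_pos[of r z] B_pos[of t z] z
        by (auto intro!: derivative_eq_intros A B)
      have "C r z / B r z + p * tanh (r * z) < C t z / B t z + p * tanh (t * z)"
        using log_deriv_decreasing[OF rst p(2) z] unfolding B_def C_def .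
      moreover have "p * (B r z - B t z) = p * tanh (r * z) - p * tanh (t * z)"
        unfolding B_def by (simp add: right_diff_distrib)
      ultimately have "C r z / B r z - C t z / B t z + p * (B r z - B t z) < 0" by simp
      with der show "\<exists>d. (Q has_real_derivative d) (at z) \<and> d < 0" by blast
    qed
    then have "exp (Q v) < exp (Q u)" by simp
    moreover have "exp (Q z) = B r z / B t z * exp (p * (A r z - A t z))" if "z > 0" for z
      using B_pos[of r z] B_pos[of t z] that rst by (simp add: Q_def exp_add exp_diff)
    ultimately show ?thesis using uv by simp
  qed
  have A0: "(A u \<longlongrightarrow> 0) (at_right 0)" if "u > 0" for u
  proof -
    have "isCont (A u) 0" using A[OF that] by (rule DERIV_isCont)
    then have "(A u \<longlongrightarrow> 0) (at 0)" by (simp add: isCont_def A_def)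
    then show ?thesis by (rule tendsto_mono[OF at_le, rotated]) simp
  qed
  \<comment> \<open>To first order at 0, \<open>B u z\<close> is \<open>(u - s) * z\<close>.\<close>
  have "((\<lambda>z. B r z / B t z) \<longlongrightarrow> (r - s) * inverse (t - s)) (at_right 0)"
    unfolding B_def using rst by real_asymp
  then have "((\<lambda>z. B r z / B t z) \<longlongrightarrow> (r - s) / (t - s)) (at_right 0)"
    by (simp add: divide_inverse)
  moreover have "((\<lambda>z. exp (p * (A r z - A t z))) \<longlongrightarrow> exp (p * (0 - 0))) (at_right 0)"
    using rst by (intro tendsto_intros A0) auto
  ultimately have lim0: "((\<lambda>z. B r z / B t z * exp (p * (A r z - A t z))) \<longlongrightarrow> (r - s) / (t - s)) (at_right 0)"
    using tendsto_mult by fastforce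
  \<comment> \<open>Since \<open>cosh (u * z)\<close> behaves like \<open>exp (u * z) / 2\<close>,
    the logarithm divided by \<open>u\<close> grows like \<open>z\<close> for every
    \<open>u\<close>. This common growth cancels in \<open>F u\<close>.\<close>
  have H_top: "((\<lambda>z. ln (cosh (u * z)) / u - z) \<longlongrightarrow> - ln 2 / u) at_top" if "u > 0" for u :: real
  proof -
    have "((\<lambda>z. ln (cosh (u * z)) / u - z) \<longlongrightarrow> ln (1 / 2) * inverse u) at_top"
      using that by real_asymp
    then show ?thesis by (simp add: ln_div inverse_eq_divide)
  qed
  have F_top: "(F u \<longlongrightarrow> L u) at_top" if "u > 0" for u
  proof -
    have "((\<lambda>z. exp (p * ((ln (cosh (u * z)) / u - z) - (ln (cosh (s * z)) / s - z))) - 1)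
        \<longlongrightarrow> exp (p * (- ln 2 / u - - ln 2 / s)) - 1) at_top"
      using that rst by (intro tendsto_intros H_top) auto
    then show ?thesis by (simp add: F_def L_def)
  qed
  have "L t \<noteq> 0" using p rst by (simp add: L_def)
  then have lim_top: "((\<lambda>z. F r z / F t z) \<longlongrightarrow> L r / L t) at_top"
    using rst by (intro tendsto_divide F_top) auto
  show ?thesis
  proof (rule monotone_lhopital_bounds[where f = "F r" and g = "F t"
        and f' = "\<lambda>z. p * B r z * exp (p * A r z)" and g' = "\<lambda>z. p * B t z * exp (p * A t z)"])
    show "p * B t z * exp (p * A t z) > 0" if "z > 0" for z
      using p B_pos[OF rst(2) that] by simp
    show "(F r has_real_derivative p * B r z * exp (p * A r z)) (at z)"
      "(F t has_real_derivative p * B t z * exp (p * A t z)) (at z)" for z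
      using rst by (auto intro: F)
    show "F r 0 = 0" "F t 0 = 0" by (simp_all add: F_def)
    show "(p * B r v * exp (p * A r v)) / (p * B t v * exp (p * A t v))
        < (p * B r u * exp (p * A r u)) / (p * B t u * exp (p * A t u))" if "0 < u" "u < v" for u v
      unfolding quot using that by (rule decr)
    show "((\<lambda>z. (p * B r z * exp (p * A r z)) / (p * B t z * exp (p * A t z))) \<longlongrightarrow> (r - s) / (t - s))
        (at_right 0)"
      unfolding quot by (rule lim0)
  qed (rule lim_top y)+
qed

theorem theorem3p3:
  fixes r t s p a b :: real
  assumes "0 < s" and "s < t" and "t < r"
    and "0 < p" and "p \<le> (4 * t + 2 * s) / 3"
    and "a > 0" and "b > 0" and "a \<noteq> b"
  shows "(2 powr (- p / r) - 2 powr (- p / s)) / (2 powr (- p / t) - 2 powr (- p / s))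
           < (power_mean r a b powr p - power_mean s a b powr p)
             / (power_mean t a b powr p - power_mean s a b powr p)
       \<and> (power_mean r a b powr p - power_mean s a b powr p)
             / (power_mean t a b powr p - power_mean s a b powr p)
           < (r - s) / (t - s)"
proof -
  define y where "y = \<bar>ln a - ln b\<bar> / 2"
  have y: "y > 0" using assms by (simp add: y_def)
  define h where "h = (\<lambda>u. p * (ln (cosh (u * y)) / u))"
  define c where "c = exp (p * (ln a + ln b) / 2)"
  \<comment> \<open>The factor \<open>c * exp (h s)\<close> is the \<open>p\<close>-th power of the
    mean of order \<open>s\<close>. It is common to numerator and denominator and cancels;
    \<open>2 powr (- p / s)\<close> plays the same role in \<open>P\<close>.\<close>
  have M: "power_mean u a b powr p - power_mean s a b powr p
      = c * exp (h s) * (exp (p * (ln (cosh (u * y)) / u - ln (cosh (s * y)) / s)) - 1)" if "u > 0" for u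
    using that assms power_mean_powr_eq[of a b u p] power_mean_powr_eq[of a b s p]
    by (simp add: h_def c_def y_def right_diff_distrib exp_diff)
  have P: "2 powr (- p / u) - 2 powr (- p / s)
      = 2 powr (- p / s) * (exp (p * (ln 2 / s - ln 2 / u)) - 1)" for u :: real
    by (simp add: powr_def right_diff_distrib exp_diff exp_minus inverse_eq_divide)
  have "c * exp (h s) \<noteq> 0" by (simp add: c_def)
  moreover have "0 < t" "0 < r" using assms by auto
  ultimately show ?thesis
    using cosh_power_difference_ratio_bounds[OF assms(1-5) y]
    unfolding P M[OF \<open>0 < t\<close>] M[OF \<open>0 < r\<close>] by simp
qed

end
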